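(* Let $q\in\mathbb{C}$ with $0<|q|<1$. Let $f(a,b)$ be a function of two complex variables that is analytic in a neighborhood of $(a,b)=(0,0)\in\mathbb{C}^2$ and satisfies there the $q$-functional equation $$af(a,b)+bf(aq,bq)=(a+b)f(a,bq).$$ Then, for $(a,b)$ near $(0,0)$, $$f(a,b)=E(bD_q)\{f(a,0)\}=\sum_{n=0}^{\infty}\frac{q^{n(n-1)/2}\,b^n}{(q;q)_n}\,D_q^n\{f(a,0)\},$$ where $D_q$ acts with respect to the variable $a$.
   Context: The $q$-shifted factorials are $(x;q)_0=1$ and $(x;q)_n=(1-x)(1-xq)\cdots(1-xq^{n-1})$ for $n\ge 1$. The $q$-derivative operator, acting on a function $g$ of the variable $a$, is $D_q\{g(a)\}=\dfrac{g(a)-g(aq)}{a}$ (with no factor $1-q$ in the denominator), with $D_q^0$ the identity and $D_q^n\{g(a)\}=D_q\{D_q^{n-1}\{g(a)\}\}$. For $g$ analytic near $0$, the removable singularity of $D_q\{g\}$ at $a=0$ is filled in; thus $D_q\{a^k\}=(1-q^k)a^{k-1}$ for $k\ge1$ and $D_q\{1\}=0$. The operator $E(bD_q)=\sum_{n\ge0}\frac{q^{n(n-1)/2}(bD_q)^n}{(q;q)_n}$ acts on a function $g(a)$ by $E(bD_q)\{g(a)\}=\sum_{n\ge0}\frac{q^{n(n-1)/2}b^n}{(q;q)_n}D_q^n\{g(a)\}$, with $b$ treated as a constant. *)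

theory Defs
  imports "HOL-Complex_Analysis.Complex_Analysis"
begin

definition q_pochhammer :: "complex \<Rightarrow> complex \<Rightarrow> nat \<Rightarrow> complex" where
  "q_pochhammer x q n = (\<Prod>k<n. 1 - x * q ^ k)"

(* The value at 0 is the limit at 0, i.e. the removable singularity is filled in.
   Lim is an unspecified value when no limit exists; for g analytic near 0 it does. *)
definition q_deriv :: "complex \<Rightarrow> (complex \<Rightarrow> complex) \<Rightarrow> complex \<Rightarrow> complex" where
  "q_deriv q g a =
     (if a = 0 then Lim (at 0) (\<lambda>x. (g x - g (x * q)) / x)
      else (g a - g (a * q)) / a)"

lemma q_deriv_const: "q_deriv q (\<lambda>_. c) = (\<lambda>_. 0)"
  by (auto simp: q_deriv_def fun_eq_iff intro!: tendsto_Lim)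

lemma q_deriv_power_Suc:
  "q_deriv q (\<lambda>a. a ^ Suc k) = (\<lambda>a. (1 - q ^ Suc k) * a ^ k)"
proof
  fix a :: complex
  have eq: "(x ^ Suc k - (x * q) ^ Suc k) / x = (1 - q ^ Suc k) * x ^ k" if "x \<noteq> 0" for x
    using that by (simp add: field_simps power_mult_distrib)
  have "((\<lambda>x. (1 - q ^ Suc k) * x ^ k) \<longlongrightarrow> (1 - q ^ Suc k) * 0 ^ k) (at 0)"
    by (intro tendsto_intros)
  also have "?this \<longleftrightarrow>
      ((\<lambda>x. (x ^ Suc k - (x * q) ^ Suc k) / x) \<longlongrightarrow> (1 - q ^ Suc k) * 0 ^ k) (at 0)"
    by (intro filterlim_cong refl) (auto simp: eventually_at_filter eq simp del: power_Suc)
  finally have "Lim (at 0) (\<lambda>x. (x ^ Suc k - (x * q) ^ Suc k) / x) = (1 - q ^ Suc k) * 0 ^ k"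
    by (intro tendsto_Lim) auto
  then show "q_deriv q (\<lambda>a. a ^ Suc k) a = (1 - q ^ Suc k) * a ^ k"
    using eq[of a] by (auto simp: q_deriv_def simp del: power_Suc)
qed

definition q_E_term ::
  "complex \<Rightarrow> complex \<Rightarrow> (complex \<Rightarrow> complex) \<Rightarrow> complex \<Rightarrow> nat \<Rightarrow> complex" where
  "q_E_term q b g a n =
     q ^ (n * (n - 1) div 2) * b ^ n / q_pochhammer q q n * (q_deriv q ^^ n) g a"

(* E(b D_q){g(a)}; meaningful only where the series converges. *)
definition q_E ::
  "complex \<Rightarrow> complex \<Rightarrow> (complex \<Rightarrow> complex) \<Rightarrow> complex \<Rightarrow> complex" where
  "q_E q b g a = (\<Sum>n. q_E_term q b g a n)"

(* Analyticity in two complex variables: around every point of U, the function is the sum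
   of an (absolutely convergent) double power series on some polydisc. *)
definition analytic2_on ::
  "(complex \<Rightarrow> complex \<Rightarrow> complex) \<Rightarrow> (complex \<times> complex) set \<Rightarrow> bool" where
  "analytic2_on f U \<longleftrightarrow>
     (\<forall>(a0, b0) \<in> U. \<exists>c :: nat \<Rightarrow> nat \<Rightarrow> complex. \<exists>r > 0.
        \<forall>a b. norm (a - a0) < r \<and> norm (b - b0) < r \<longrightarrow>
          ((\<lambda>(m, n). c m n * (a - a0) ^ m * (b - b0) ^ n) has_sum f a b) UNIV)"

end

(* Expand f in powers of b with coefficients A n analytic in a. Comparing coefficients of
   b^(n+1) in the functional equation yields
     a (1 - q^(n+1)) A (n+1) a = q^n (A n a - A n (a q)),
   that is, A (n+1) = q^n / (1 - q^(n+1)) D_q (A n). Iterating from A 0 = f(., 0) gives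
   A n = q^(n(n-1)/2) / (q;q)_n D_q^n f(., 0), so the series in the theorem is just the
   expansion of f in powers of b. *)
theory Submission
  imports Defs
begin

text \<open>Away from 0 this is division by \<open>x\<close>. At 0 the difference quotient agrees
  with \<open>h\<close> on a punctured disc, so continuity of \<open>h\<close> supplies the limit
  that fills the removable singularity.\<close>

lemma q_deriv_eqI:
  fixes g h :: "complex \<Rightarrow> complex"
  assumes "0 < r" and cont: "isCont h 0"
    and eq: "\<And>x. norm x < r \<Longrightarrow> g x - g (x * q) = x * h x"
    and "norm x < r"
  shows "q_deriv q g x = h x"
proof (cases "x = 0")
  case False
  with eq[OF \<open>norm x < r\<close>] show ?thesis by (simp add: q_deriv_def)
next
  case True
  have "\<forall>\<^sub>F y in at 0. h y = (g y - g (y * q)) / y"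
    using \<open>0 < r\<close> by (auto simp: eventually_at eq intro!: exI[of _ r])
  moreover have "(h \<longlongrightarrow> h 0) (at 0)"
    using cont by (simp add: isCont_def)
  ultimately have "((\<lambda>y. (g y - g (y * q)) / y) \<longlongrightarrow> h 0) (at 0)"
    by (rule Lim_transform_eventually[rotated])
  then show ?thesis
    using True by (simp add: q_deriv_def tendsto_Lim)
qed

lemma norm_mult_less_radius:
  fixes x q :: complex
  assumes "norm x < r" and "norm q < 1"
  shows "norm (x * q) < r"
  using mult_left_le[of "norm q" "norm x"] assms by (simp add: norm_mult)

text \<open>A nonzero coefficient of positive index would make the zero of the sum at the origin
  isolated, which is absurd for the zero function. Index 0 is settled separately by evaluating at
  \<open>x = 0\<close>.\<close>

lemma powser_eq_0:
  fixes h :: "nat \<Rightarrow> complex"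
  assumes "0 < r" and "\<And>x. norm x < r \<Longrightarrow> (\<lambda>n. h n * x ^ n) sums 0"
  shows "h n = 0"
proof (rule ccontr)
  assume "h n \<noteq> 0"
  moreover have "h 0 = 0"
    using assms(2)[of 0] powser_sums_zero[of h] \<open>0 < r\<close> sums_unique2 by auto
  ultimately have "n > 0" by (cases n) auto
  show False
  proof (rule powser_0_nonzero[of r 0 h "\<lambda>_. 0" n])
    fix s :: real
    assume "0 < s" and "\<And>z. (z :: complex) \<in> cball 0 s - {0} \<Longrightarrow> (0 :: complex) \<noteq> 0"
    from this(1) this(2)[of "of_real s"] show False by simp
  qed (use assms \<open>n > 0\<close> \<open>h n \<noteq> 0\<close> in auto)
qed

text \<open>Fubini for absolutely convergent sums: for each \<open>n\<close>, summing over
  \<open>m\<close> first gives the coefficient of \<open>b ^ n\<close>. Continuity of the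
  coefficients at 0 is recorded for the limit in \<open>q_deriv_eqI\<close>.\<close>

lemma double_powser_slices:
  fixes c :: "nat \<Rightarrow> nat \<Rightarrow> complex"
  assumes "0 < r"
    and sum: "\<And>a b. norm a < r \<Longrightarrow> norm b < r \<Longrightarrow>
           ((\<lambda>(m, n). c m n * a ^ m * b ^ n) has_sum f a b) UNIV"
  obtains A where "\<And>n. isCont (A n) 0"
    and "\<And>a b. norm a < r \<Longrightarrow> norm b < r \<Longrightarrow> (\<lambda>n. A n a * b ^ n) sums f a b"
proof
  define A where "A n a = (\<Sum>m. c m n * a ^ m)" for n a
  \<comment> \<open>A nonzero point of the disc: the factor \<open>b0 ^ n\<close> can be cancelled
    from the summable slice at \<open>b = b0\<close>. As a value of \<open>a\<close>, it also
    witnesses a positive radius of convergence for \<open>A n\<close>.\<close>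
  define b0 :: complex where "b0 = of_real (r / 2)"
  have b0: "norm b0 < r" "b0 \<noteq> 0"
    using \<open>0 < r\<close> by (auto simp: b0_def)
  have swap: "((\<lambda>(n, m). c m n * a ^ m * b ^ n) has_sum f a b) (UNIV \<times> UNIV)"
    if "norm a < r" "norm b < r" for a b
    by (subst has_sum_swap) (use sum[OF that] in simp)
  have summable: "(\<lambda>m. c m n * a ^ m) summable_on UNIV" if "norm a < r" for a n
  proof -
    have "(\<lambda>(n, m). c m n * a ^ m * b0 ^ n) summable_on (UNIV \<times> UNIV)"
      using swap[OF that b0(1)] by (auto simp: summable_on_def)
    from summable_on_SigmaD1[OF this, of n]
    have "(\<lambda>m. c m n * a ^ m * b0 ^ n) summable_on UNIV" by simp
    then show ?thesis using b0 by (simp add: summable_on_cmult_left')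
  qed
  have A: "((\<lambda>m. c m n * a ^ m) has_sum A n a) UNIV" if "norm a < r" for a n
    using has_sum_infsum[OF summable[OF that, of n]] has_sum_imp_sums sums_unique
    unfolding A_def by metis
  show "isCont (A n) 0" for n
    unfolding A_def
    using summable_on_imp_summable[OF summable[OF b0(1), of n]] b0(2)
    by (intro isCont_powser[where K = b0]) auto
  show "(\<lambda>n. A n a * b ^ n) sums f a b" if "norm a < r" "norm b < r" for a b
  proof (rule has_sum_imp_sums)
    have "((\<lambda>m. c m n * a ^ m * b ^ n) has_sum A n a * b ^ n) UNIV" for n
      by (rule has_sum_cmult_left[OF A[OF that(1)]])
    then show "((\<lambda>n. A n a * b ^ n) has_sum f a b) UNIV"
      by (intro has_sum_SigmaD[OF swap[OF that]]) simp
  qed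
qed

text \<open>Written as a (f(a,b) - f(a,bq)) + b (f(aq,bq) - f(a,bq)) = 0, the functional equation
  is, for fixed \<open>a\<close>, a vanishing power series in \<open>b\<close>.\<close>

lemma q_functional_coeff:
  fixes A :: "nat \<Rightarrow> complex \<Rightarrow> complex"
  assumes "0 < r" and "norm q < 1" and "norm a < r"
    and sums: "\<And>a b. norm a < r \<Longrightarrow> norm b < r \<Longrightarrow> (\<lambda>n. A n a * b ^ n) sums f a b"
    and fe: "\<And>b. norm b < r \<Longrightarrow>
           a * f a b + b * f (a * q) (b * q) = (a + b) * f a (b * q)"
  shows "q ^ n * (A n a - A n (a * q)) = a * ((1 - q ^ Suc n) * A (Suc n) a)"
proof -
  \<comment> \<open>\<open>h n\<close> is the coefficient of \<open>b ^ n\<close> in that series.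
    The outer factor \<open>b\<close> of the second summand shifts its index by one, hence the case
    split.\<close>
  define h where "h n = a * ((1 - q ^ n) * A n a)
    + (case n of 0 \<Rightarrow> 0 | Suc k \<Rightarrow> q ^ k * (A k (a * q) - A k a))" for n
  note small = norm_mult_less_radius[OF _ \<open>norm q < 1\<close>]
  have "h (Suc n) = 0"
  proof (rule powser_eq_0[OF \<open>0 < r\<close>])
    fix b :: complex
    assume b: "norm b < r"
    note a = \<open>norm a < r\<close>
    have shifted: "(\<lambda>n. case n of 0 \<Rightarrow> 0
        | Suc k \<Rightarrow> b * (A k (a * q) * (b * q) ^ k - A k a * (b * q) ^ k))
        sums (b * (f (a * q) (b * q) - f a (b * q)))"
      by (rule sums_Suc_imp) (auto intro!: sums_mult sums_diff sums small a b)
    have "(\<lambda>n. a * (A n a * b ^ n - A n a * (b * q) ^ n)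
        + (case n of 0 \<Rightarrow> 0
            | Suc k \<Rightarrow> b * (A k (a * q) * (b * q) ^ k - A k a * (b * q) ^ k)))
        sums (a * (f a b - f a (b * q)) + b * (f (a * q) (b * q) - f a (b * q)))"
      by (intro sums_add shifted sums_mult sums_diff sums small a b)
    also have "a * (f a b - f a (b * q)) + b * (f (a * q) (b * q) - f a (b * q)) = 0"
      using fe[OF b] by (simp add: algebra_simps)
    also have "(\<lambda>n. a * (A n a * b ^ n - A n a * (b * q) ^ n)
        + (case n of 0 \<Rightarrow> 0
            | Suc k \<Rightarrow> b * (A k (a * q) * (b * q) ^ k - A k a * (b * q) ^ k)))
        = (\<lambda>n. h n * b ^ n)"
      by (auto simp: fun_eq_iff h_def power_mult_distrib algebra_simps split: nat.splits)
    finally show "(\<lambda>n. h n * b ^ n) sums 0" .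
  qed
  then show ?thesis
    by (simp add: h_def algebra_simps)
qed

lemma q_pochhammer_Suc:
  "q_pochhammer x q (Suc n) = q_pochhammer x q n * (1 - x * q ^ n)"
  by (simp add: q_pochhammer_def)

lemma one_minus_power_neq_0:
  fixes q :: complex
  assumes "norm q < 1"
  shows "1 - q ^ Suc n \<noteq> 0"
proof
  assume "1 - q ^ Suc n = 0"
  then have "norm q ^ Suc n = 1"
    by (metis eq_iff_diff_eq_0 norm_one norm_power)
  with power_Suc_less_one[of "norm q" n] assms show False
    by (cases "q = 0") auto
qed

lemma q_pochhammer_neq_0: "norm q < 1 \<Longrightarrow> q_pochhammer q q n \<noteq> 0"
  using one_minus_power_neq_0[of q] by (simp add: q_pochhammer_def)

text \<open>The increment \<open>n * 2\<close> passes through \<open>div 2\<close> exactly, so no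
  parity argument arises.\<close>

lemma triangle_Suc: "Suc n * (Suc n - 1) div 2 = n * (n - 1) div 2 + (n::nat)"
proof -
  have "Suc n * (Suc n - 1) = n * (n - 1) + n * 2"
    by (cases n) auto
  then show ?thesis by simp
qed

text \<open>Solves the recurrence by induction on \<open>n\<close>. \<open>g\<close> is tied to
  \<open>A 0\<close> on the disc only, because the power series represents \<open>f\<close> only
  near the origin.\<close>

lemma q_deriv_funpow_coeff:
  fixes A :: "nat \<Rightarrow> complex \<Rightarrow> complex"
  assumes "0 < r" and q: "q \<noteq> 0" "norm q < 1"
    and cont: "\<And>n. isCont (A n) 0"
    and rec: "\<And>n a. norm a < r \<Longrightarrow>
           q ^ n * (A n a - A n (a * q)) = a * ((1 - q ^ Suc n) * A (Suc n) a)"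
    and g: "\<And>a. norm a < r \<Longrightarrow> g a = A 0 a"
    and "norm a < r"
  shows "q ^ (n * (n - 1) div 2) / q_pochhammer q q n * (q_deriv q ^^ n) g a = A n a"
proof -
  \<comment> \<open>Chosen so that \<open>K (Suc n) / K n\<close> is the factor
    \<open>q ^ n / (1 - q ^ Suc n)\<close> of the recurrence; \<open>q \<noteq> 0\<close> makes
    division by \<open>K n\<close> legitimate.\<close>
  define K where "K n = q ^ (n * (n - 1) div 2) / q_pochhammer q q n" for n
  have K0: "K n \<noteq> 0" for n
    using q q_pochhammer_neq_0[of q n] by (simp add: K_def)
  have K_Suc: "K (Suc n) * (1 - q ^ Suc n) = K n * q ^ n" for n
    using one_minus_power_neq_0[OF q(2), of n] q_pochhammer_neq_0[OF q(2), of n]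
    unfolding K_def q_pochhammer_Suc triangle_Suc power_add by (simp add: field_simps)
  note small = norm_mult_less_radius[OF _ q(2)]
  \<comment> \<open>The point stays arbitrary: one more \<open>q_deriv\<close> involves
    \<open>x\<close> and \<open>x * q\<close>, and at 0 a whole punctured disc.\<close>
  have "(q_deriv q ^^ n) g a = A n a / K n" if "norm a < r" for a
    using that
  proof (induction n arbitrary: a)
    case 0
    then show ?case by (simp add: g K_def q_pochhammer_def)
  next
    case (Suc n)
    have "q_deriv q ((q_deriv q ^^ n) g) a = A (Suc n) a / K (Suc n)"
    proof (rule q_deriv_eqI[OF \<open>0 < r\<close> _ _ Suc.prems])
      show "isCont (\<lambda>a. A (Suc n) a / K (Suc n)) 0"
        using cont K0 by (intro continuous_intros) auto
      fix x :: complex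
      assume x: "norm x < r"
      \<comment> \<open>The extra factor, cancelled afterwards, lets \<open>K_Suc\<close> and
        \<open>rec\<close> both apply.\<close>
      have "(1 - q ^ Suc n) * (K (Suc n) * (A n x - A n (x * q)))
          = K n * (q ^ n * (A n x - A n (x * q)))"
        by (metis K_Suc mult.assoc mult.commute)
      also have "\<dots> = (1 - q ^ Suc n) * (K n * (x * A (Suc n) x))"
        unfolding rec[OF x] by (simp only: mult_ac)
      finally have "K (Suc n) * (A n x - A n (x * q)) = K n * (x * A (Suc n) x)"
        using one_minus_power_neq_0[OF q(2), of n] by (metis mult_left_cancel)
      then show "(q_deriv q ^^ n) g x - (q_deriv q ^^ n) g (x * q)
          = x * (A (Suc n) x / K (Suc n))"
        unfolding Suc.IH[OF x] Suc.IH[OF small[OF x]] using K0 by (simp add: field_simps)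
    qed
    then show ?case by simp
  qed
  then show ?thesis
    using K0[of n] \<open>norm a < r\<close> unfolding K_def[symmetric] by simp
qed

text \<open>The \<open>sums\<close> conjunct asserts convergence, without which the infinite sum in
  \<open>q_E\<close> would carry no information. The functional equation is assumed only where all
  its arguments lie in \<open>U\<close>, since \<open>U\<close> need not be stable under scaling by
  \<open>q\<close>.\<close>

theorem theorem2p3:
  fixes q :: complex and f :: "complex \<Rightarrow> complex \<Rightarrow> complex"
    and U :: "(complex \<times> complex) set"
  assumes "0 < norm q" and "norm q < 1"
    and "open U" and "(0, 0) \<in> U"
    and "analytic2_on f U"
    and "\<And>a b. (a, b) \<in> U \<Longrightarrow> (a, b * q) \<in> U \<Longrightarrow> (a * q, b * q) \<in> U \<Longrightarrow>
           a * f a b + b * f (a * q) (b * q) = (a + b) * f a (b * q)"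
  shows "\<forall>\<^sub>F (a, b) in nhds (0, 0).
           f a b = q_E q b (\<lambda>x. f x 0) a \<and>
           (\<lambda>n. q ^ (n * (n - 1) div 2) * b ^ n / q_pochhammer q q n
                  * (q_deriv q ^^ n) (\<lambda>x. f x 0) a) sums f a b"
proof -
  obtain c r1 where "0 < r1" and c: "\<And>a b. norm a < r1 \<Longrightarrow> norm b < r1 \<Longrightarrow>
      ((\<lambda>(m, n). c m n * a ^ m * b ^ n) has_sum f a b) UNIV"
    using \<open>analytic2_on f U\<close> \<open>(0, 0) \<in> U\<close> unfolding analytic2_on_def by fastforce
  obtain S T where ST: "open S" "open T" "0 \<in> S" "0 \<in> T" "S \<times> T \<subseteq> U"
    using \<open>open U\<close> \<open>(0, 0) \<in> U\<close> by (auto elim!: open_prod_elim)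
  then obtain r2 where "0 < r2" and r2: "ball 0 r2 \<subseteq> S \<inter> T"
    by (metis Int_iff open_Int open_contains_ball)
  \<comment> \<open>On this bidisc the expansion holds, and it lies in \<open>U\<close>. It is
    stable under scaling either coordinate by \<open>q\<close>, so the functional equation is
    available throughout.\<close>
  define r where "r = min r1 r2"
  have r: "0 < r" using \<open>0 < r1\<close> \<open>0 < r2\<close> by (simp add: r_def)
  have inU: "(a, b) \<in> U" if "norm a < r" "norm b < r" for a b
    using that r2 ST(5) by (force simp: r_def subset_iff)
  note small = norm_mult_less_radius[OF _ \<open>norm q < 1\<close>]
  have c': "((\<lambda>(m, n). c m n * a ^ m * b ^ n) has_sum f a b) UNIV"
    if "norm a < r" "norm b < r" for a b
    using that by (intro c) (auto simp: r_def)
  obtain A where cont: "\<And>n. isCont (A n) 0"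
    and sums: "\<And>a b. norm a < r \<Longrightarrow> norm b < r \<Longrightarrow> (\<lambda>n. A n a * b ^ n) sums f a b"
    using double_powser_slices[OF r, of c f] c' by blast
  have rec: "q ^ n * (A n a - A n (a * q)) = a * ((1 - q ^ Suc n) * A (Suc n) a)"
    if "norm a < r" for n a
    using that
    by (intro q_functional_coeff[where f = f, OF r \<open>norm q < 1\<close>] sums assms(6) inU small)
  \<comment> \<open>At \<open>b = 0\<close> only the term of index 0 survives, as
    \<open>0 ^ 0 = 1\<close>.\<close>
  have A0: "f a 0 = A 0 a" if "norm a < r" for a
    using sums[OF that, of 0] powser_sums_zero[of "\<lambda>n. A n a"] r sums_unique2 by auto
  have *: "(\<lambda>n. q ^ (n * (n - 1) div 2) * b ^ n / q_pochhammer q q n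
      * (q_deriv q ^^ n) (\<lambda>x. f x 0) a) sums f a b"
    if "norm a < r" "norm b < r" for a b
  proof -
    have "q ^ (n * (n - 1) div 2) / q_pochhammer q q n * (q_deriv q ^^ n) (\<lambda>x. f x 0) a = A n a"
      for n
      by (rule q_deriv_funpow_coeff[OF r _ _ cont rec A0 that(1)]) (use assms(1,2) in auto)
    then have "q ^ (n * (n - 1) div 2) * b ^ n / q_pochhammer q q n
        * (q_deriv q ^^ n) (\<lambda>x. f x 0) a = A n a * b ^ n" for n
      by (metis mult.assoc mult.commute times_divide_eq_left)
    with sums[OF that] show ?thesis by simp
  qed
  have "\<forall>\<^sub>F p in nhds (0, 0). p \<in> ball (0 :: complex) r \<times> ball (0 :: complex) r"
    using r by (intro eventually_nhds_in_open open_Times) auto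
  then show ?thesis
  proof eventually_elim
    case (elim p)
    then obtain a b where p: "p = (a, b)" and "norm a < r" "norm b < r"
      by auto
    from *[OF this(2,3)] show ?case
      unfolding p prod.case q_E_def q_E_term_def by (intro conjI sums_unique)
  qed
qed

end
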